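(* Consider the three optimization problems (D), (S), (B) described in the context: the deterministic problem (D), the stochastic problem (S) with controllers acting on beliefs, and the original stochastic problem (B). An optimal design $(c^*,l^*,g^* )$ for (D) (and consequently for (S) and thereby for (B)) is given by the following nested optimality equations: $$V^g_T(\pi^g)=\inf_{g_T\in\mathscr G_s}\tilde\rho(\pi^g,g_T),$$ $$V^c_t(\pi^c)=\min_{c_t\in\mathscr C}V^l_t\big(Q^c(c_t)\pi^c\big),\qquad V^l_t(\pi^l)=\min_{l_t\in\mathscr L}V^g_t\big(Q^l(l_t)\pi^l\big),\qquad t=1,\dots,T,$$ $$V^g_t(\pi^g)=\inf_{g_t\in\mathscr G_s}\Big[\tilde\rho(\pi^g,g_t)+V^c_{t+1}\big(Q^g(g_t)\pi^g\big)\Big],\qquad t=1,\dots,T-1.$$ The $\arg\min$ (or $\arg\inf$) at each step determines the corresponding optimal design for that stage. Furthermore, the optimal performance is given by $$\mathcal J_T^*=V^c_1(\pi^c_1).$$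
   Context: Perfect observation system. $\mathcal X,\mathcal W,\mathcal M,\mathcal Z,\mathcal N,\mathcal Y,\mathcal U$ are finite sets and $T$ is a finite horizon. For a sequence, $x^t$ denotes $(x_1,\dots,x_t)$. For $t=1,\dots,T$: - Plant: $X_{t+1}=f(X_t,U_t,W_t)$, with state $X_t\in\mathcal X$, control $U_t\in\mathcal U$, disturbance $W_t\in\mathcal W$. $X_1$ has PMF $P_{X_1}$; $W_1,\dots,W_T$ are i.i.d. with PMF $P_W$ and independent of $X_1$. - Encoder: $Z_t=c_t(X_t,M_{t-1})\in\mathcal Z$, with $c_t\in\mathscr C$, the set of functions $\mathcal X\times\mathcal M\to\mathcal Z$; $M_{t-1}$ is the content of the sensor's memory at $t-1$. - Sensor memory: $M_t=l_t(X_t,M_{t-1})\in\mathcal M$, with $l_t\in\mathscr L$, the set of functions $\mathcal X\times\mathcal M\to\mathcal M$. - Channel: $Y_t=h(Z_t,N_t)\in\mathcal Y$; the noises $N_1,\dots,N_T\in\mathcal N$ are i.i.d. with PMF $P_N$ and independent of $X_1,W_1,\dots,W_T$. - Controller: $U_t=g_t(Y^t,U^{t-1})$ with $g_t\in\mathscr G_t$, the set of functions $\mathcal Y^t\times\mathcal U^{t-1}\to\mathcal U$. The functions $f,h$ are given, as is a cost $\rho:\mathcal X\times\mathcal U\to[0,K]$, $K<\infty$. The performance of a design $(c,l,g)$ is $\mathcal J_T(c,l,g)=\mathbb E\{\sum_{t=1}^T\rho(X_t,U_t)\mid c,l,g\}$. Problem (B): minimize $\mathcal J_T(c,l,g)$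 over $\mathscr C^T\times\mathscr L^T\times\mathscr G_1\times\dots\times\mathscr G_T$; the minimum is $\mathcal J_T^*$. Beliefs. $\mathcal P^{\mathcal X\times\mathcal M}$ is the set of PMFs on $\mathcal X\times\mathcal M$. Under the decision rules in use, $P_{X_t,M_t}$ is the conditional PMF of $(X_t,M_t)$ given $(Y^t,U^{t-1})$; $P_{X_{t+1},M_t}$ is that of $(X_{t+1},M_t)$ given $(Y^t,U^t)$; $P^+_{X_{t+1},M_t}$ is that of $(X_{t+1},M_t)$ given $(Y^{t+1},U^t)$. Problem (S): let $\mathscr G_s$ be the set of functions $\mathcal P^{\mathcal X\times\mathcal M}\to\mathcal U$, used through $U_t=g_t(P_{X_t,M_t})$; minimize $\mathcal J_T(c,l,g)$ over $\mathscr C^T\times\mathscr L^T\times\mathscr G_s^T$. Problem (S) is equivalent to (B), with the same optimal value $\mathcal J_T^*$. Information states. $\Pi$ is the space of probability measures on $\mathcal X\times\mathcal M\times\mathcal P^{\mathcal X\times\mathcal M}$, and $\pi^c_t,\pi^l_t,\pi^g_t\in\Pi$ are the (unconditional) joint laws of $(X_t,M_{t-1},P_{X_t,M_{t-1}})$, $(X_t,M_{t-1},P^+_{X_t,M_{t-1}})$ and $(X_t,M_t,P_{X_t,M_t})$ respectively. They evolve by linear transformations $Q^c(c_t),Q^l(l_t),Q^g(g_t)$, and the expected instantaneous cost is $\mathbb E\{\rho(X_t,U_t)\mid c^t,l^t,g^t\}=\tilde\rho(\pi^g_t,g_t)$. Explicitly, for $(x,m,p)\sim\pi$, with $W\sim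 P_W$ and $N\sim P_N$ independent of $(x,m,p)$: - $Q^c(c)\pi$ is the law of $(x,m,p^+)$, where $p^+$ is the Bayes update of $p$ given the channel output $y=h(c(x,m),N)$, i.e. $p^+(x',m')$ is proportional to $p(x',m')\Pr(h(c(x',m'),N)=y)$; - $Q^l(l)\pi$ is the law of $(x,l(x,m),p')$, where $p'(x',m')=\sum_{m''}p(x',m'')\mathbf 1[m'=l(x',m'')]$; - $Q^g(g)\pi$ is the law of $(f(x,g(p),W),m,p'')$, where $p''(x',m')=\sum_{\bar x}p(\bar x,m')\Pr(f(\bar x,g(p),W)=x')$; - $\tilde\rho(\pi,g)$ is the expectation of $\rho(x,g(p))$. Problem (D): consider the deterministic system with states $\pi^c_t,\pi^l_t,\pi^g_t$, known initial state $\pi^c_1$, and evolution $$\pi^l_t=Q^c(c_t)\pi^c_t,\qquad \pi^g_t=Q^l(l_t)\pi^l_t,\qquad \pi^c_{t+1}=Q^g(g_t)\pi^g_t,$$ with $c_t\in\mathscr C$, $l_t\in\mathscr L$, $g_t\in\mathscr G_s$ and instantaneous cost $\tilde\rho(\pi^g_t,g_t)$. Determine $(c,l,g)\in\mathscr C^T\times\mathscr L^T\times\mathscr G_s^T$ minimizing $\sum_{t=1}^T\tilde\rho(\pi^g_t,g_t)$. *)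

theory Defs
  imports "HOL-Probability.Probability"
begin

text \<open>
  A feedback system whose encoder and sensor memory observe the plant state perfectly, and whose
  controller sees the output of a noisy channel.  The alphabets are type parameters (of class
  \<open>finite\<close> below).  The sensor memory starts from the fixed content \<open>mem0\<close>, the \<open>M\<close> at time 0.
\<close>

record ('x, 'w, 'm, 'z, 'n, 'y, 'u) feedback_system =
  plant   :: "'x \<Rightarrow> 'u \<Rightarrow> 'w \<Rightarrow> 'x"
  channel :: "'z \<Rightarrow> 'n \<Rightarrow> 'y"
  cost    :: "'x \<Rightarrow> 'u \<Rightarrow> real"
  law_X1  :: "'x pmf"
  law_W   :: "'w pmf"
  law_N   :: "'n pmf"
  mem0    :: "'m"
  horizon :: nat

text \<open>
  Rules are families indexed by the stage; only the stages \<open>1, \<dots>, horizon\<close> are ever used.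
  A history-dependent controller gets the channel outputs and the past controls as lists, oldest entry
  first, which at stage \<open>t\<close> have lengths \<open>t\<close> and \<open>t - 1\<close>.
\<close>

type_synonym ('x, 'm, 'z) encoders = "nat \<Rightarrow> 'x \<times> 'm \<Rightarrow> 'z"
type_synonym ('x, 'm) updates = "nat \<Rightarrow> 'x \<times> 'm \<Rightarrow> 'm"
type_synonym ('y, 'u) controllers = "nat \<Rightarrow> 'y list \<Rightarrow> 'u list \<Rightarrow> 'u"
type_synonym ('x, 'm) belief = "('x \<times> 'm) pmf"
type_synonym ('x, 'm, 'u) belief_controllers = "nat \<Rightarrow> ('x, 'm) belief \<Rightarrow> 'u"


subsection \<open>The stochastic system\<close>

text \<open>
  The sample space carries the primitive random variables: the initial state, the disturbances and
  the channel noises, all independent.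
\<close>

type_synonym ('x, 'w, 'n) sample = "'x \<times> (nat \<Rightarrow> 'w) \<times> (nat \<Rightarrow> 'n)"

definition sample_law ::
    "('x, 'w, 'm, 'z, 'n, 'y, 'u) feedback_system \<Rightarrow> ('x, 'w, 'n) sample pmf" where
  "sample_law S =
     pair_pmf (law_X1 S)
       (pair_pmf (Pi_pmf {1..horizon S} undefined (\<lambda>_. law_W S))
                 (Pi_pmf {1..horizon S} undefined (\<lambda>_. law_N S)))"

text \<open>
  After \<open>k\<close> stages, \<open>run\<close> holds the state at time \<open>k + 1\<close>, the memory content at time \<open>k\<close>, and the
  channel outputs and the controls of the stages \<open>1, \<dots>, k\<close>.
\<close>

primrec run ::
    "('x, 'w, 'm, 'z, 'n, 'y, 'u) feedback_system \<Rightarrow> ('x, 'm, 'z) encoders \<Rightarrow> ('x, 'm) updates \<Rightarrow>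
     ('y, 'u) controllers \<Rightarrow> ('x, 'w, 'n) sample \<Rightarrow> nat \<Rightarrow> 'x \<times> 'm \<times> 'y list \<times> 'u list" where
  "run S c l g \<omega> 0 = (fst \<omega>, mem0 S, [], [])"
| "run S c l g \<omega> (Suc k) =
     (case (run S c l g \<omega> k, \<omega>) of ((x, m, ys, us), (_, w, n)) \<Rightarrow>
        let t = Suc k;
            z = c t (x, m);
            m' = l t (x, m);
            ys' = ys @ [channel S z (n t)];
            u = g t ys' us
        in (plant S x u (w t), m', ys', us @ [u]))"

definition X_at where "X_at S c l g \<omega> t = fst (run S c l g \<omega> (t - 1))"
definition M_at where "M_at S c l g \<omega> t = fst (snd (run S c l g \<omega> t))"
definition outputs where "outputs S c l g \<omega> t = fst (snd (snd (run S c l g \<omega> t)))"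
definition controls where "controls S c l g \<omega> t = snd (snd (snd (run S c l g \<omega> t)))"
definition U_at where
  "U_at S c l g \<omega> t = g t (outputs S c l g \<omega> t) (controls S c l g \<omega> (t - 1))"

lemma X_at_1: "X_at S c l g (x1, w, n) 1 = x1"
  by (simp add: X_at_def)

lemma M_at_0: "M_at S c l g \<omega> 0 = mem0 S"
  by (simp add: M_at_def)

lemma outputs_controls_0: "outputs S c l g \<omega> 0 = []" "controls S c l g \<omega> 0 = []"
  by (simp_all add: outputs_def controls_def)

lemma system_equations:
  assumes "t \<ge> 1"
  shows "X_at S c l g (x1, w, n) (t + 1) =
           plant S (X_at S c l g (x1, w, n) t) (U_at S c l g (x1, w, n) t) (w t)"
    and "M_at S c l g (x1, w, n) t =
           l t (X_at S c l g (x1, w, n) t, M_at S c l g (x1, w, n) (t - 1))"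
    and "outputs S c l g (x1, w, n) t = outputs S c l g (x1, w, n) (t - 1) @
           [channel S (c t (X_at S c l g (x1, w, n) t, M_at S c l g (x1, w, n) (t - 1))) (n t)]"
    and "controls S c l g (x1, w, n) t =
           controls S c l g (x1, w, n) (t - 1) @ [U_at S c l g (x1, w, n) t]"
  using assms
  by (cases t; simp add: X_at_def M_at_def outputs_def controls_def U_at_def Let_def
        split: prod.splits)+

definition perf ::
    "('x, 'w, 'm, 'z, 'n, 'y, 'u) feedback_system \<Rightarrow> ('x, 'm, 'z) encoders \<Rightarrow> ('x, 'm) updates \<Rightarrow>
     ('y, 'u) controllers \<Rightarrow> real" where
  "perf S c l g =
     measure_pmf.expectation (sample_law S)
       (\<lambda>\<omega>. \<Sum>t = 1..horizon S. cost S (X_at S c l g \<omega> t) (U_at S c l g \<omega> t))"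

text \<open>
  The suffixes B, S and D stand for the stochastic problem with controllers acting on the full
  history, the stochastic problem with controllers acting on beliefs, and the deterministic problem
  on information states.
\<close>

definition optimal_B where
  "optimal_B S c l g \<longleftrightarrow> (\<forall>c' l' g'. perf S c l g \<le> perf S c' l' g')"

definition optimal_perf :: "('x, 'w, 'm, 'z, 'n, 'y, 'u) feedback_system \<Rightarrow> real" where
  "optimal_perf S = (INF (c, l, g). perf S c l g)"


subsection \<open>Controllers acting on beliefs\<close>

text \<open>
  The conditional PMF of \<open>(X_at t, M_at t)\<close> given the outputs up to \<open>t\<close> and the controls up to
  \<open>t - 1\<close>.  For histories of probability zero, \<^const>\<open>cond_pmf\<close> is unspecified.
\<close>

definition belief ::
    "('x, 'w, 'm, 'z, 'n, 'y, 'u) feedback_system \<Rightarrow> ('x, 'm, 'z) encoders \<Rightarrow> ('x, 'm) updates \<Rightarrow>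
     ('y, 'u) controllers \<Rightarrow> nat \<Rightarrow> 'y list \<Rightarrow> 'u list \<Rightarrow> ('x, 'm) belief" where
  "belief S c l g t ys us =
     map_pmf (\<lambda>\<omega>. (X_at S c l g \<omega> t, M_at S c l g \<omega> t))
       (cond_pmf (sample_law S)
          {\<omega>. outputs S c l g \<omega> t = ys \<and> controls S c l g \<omega> (t - 1) = us})"

text \<open>
  The history-dependent controllers that result from applying \<open>\<gamma> t\<close> to the belief at stage \<open>t\<close>.
  The belief at stage \<open>t\<close> depends on the control laws of the earlier stages only, so these are built
  up stage by stage; \<open>induced_eq\<close> below is the defining property.
\<close>

primrec induced_upto ::
    "('x, 'w, 'm, 'z, 'n, 'y, 'u) feedback_system \<Rightarrow> ('x, 'm, 'z) encoders \<Rightarrow> ('x, 'm) updates \<Rightarrow>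
     ('x, 'm, 'u) belief_controllers \<Rightarrow> nat \<Rightarrow> ('y, 'u) controllers" where
  "induced_upto S c l \<gamma> 0 = (\<lambda>_ _ _. undefined)"
| "induced_upto S c l \<gamma> (Suc k) =
     (induced_upto S c l \<gamma> k)
       (Suc k := \<lambda>ys us. \<gamma> (Suc k) (belief S c l (induced_upto S c l \<gamma> k) (Suc k) ys us))"

definition induced where
  "induced S c l \<gamma> = induced_upto S c l \<gamma> (horizon S)"

lemma run_cong:
  assumes "\<And>t. 1 \<le> t \<Longrightarrow> t \<le> k \<Longrightarrow> g t = g' t"
  shows "run S c l g \<omega> k = run S c l g' \<omega> k"
  using assms by (induction k) (auto split: prod.splits)

lemma belief_cong:
  assumes "\<And>s. 1 \<le> s \<Longrightarrow> s < t \<Longrightarrow> g s = g' s" "t \<ge> 1"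
  shows "belief S c l g t = belief S c l g' t"
proof -
  obtain k where t: "t = Suc k" using assms(2) by (cases t) auto
  have r: "run S c l g \<omega> k = run S c l g' \<omega> k" for \<omega>
    by (rule run_cong) (use assms t in auto)
  have "X_at S c l g \<omega> t = X_at S c l g' \<omega> t"
       "M_at S c l g \<omega> t = M_at S c l g' \<omega> t"
       "outputs S c l g \<omega> t = outputs S c l g' \<omega> t"
       "controls S c l g \<omega> (t - 1) = controls S c l g' \<omega> (t - 1)" for \<omega>
    using r[of \<omega>]
    by (auto simp: t X_at_def M_at_def outputs_def controls_def Let_def split: prod.splits)
  then show ?thesis by (simp add: belief_def fun_eq_iff)
qed

lemma induced_upto_stable:
  "t \<le> k \<Longrightarrow> induced_upto S c l \<gamma> k t = induced_upto S c l \<gamma> t t"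
  by (induction k) (auto simp: le_Suc_eq)

lemma induced_eq:
  assumes "1 \<le> t" "t \<le> horizon S"
  shows "induced S c l \<gamma> t ys us = \<gamma> t (belief S c l (induced S c l \<gamma>) t ys us)"
proof -
  obtain k where t: "t = Suc k" using assms by (cases t) auto
  have "belief S c l (induced_upto S c l \<gamma> k) t = belief S c l (induced S c l \<gamma>) t"
  proof (rule belief_cong)
    fix s assume "1 \<le> s" "s < t"
    then show "induced_upto S c l \<gamma> k s = induced S c l \<gamma> s"
      using assms t induced_upto_stable[of s k S c l \<gamma>]
        induced_upto_stable[of s "horizon S" S c l \<gamma>]
      by (simp add: induced_def del: induced_upto.simps)
  qed (use assms in auto)
  then show ?thesis
    using induced_upto_stable[of t "horizon S" S c l \<gamma>] assms by (simp add: induced_def t)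
qed

definition perf_S where
  "perf_S S c l \<gamma> = perf S c l (induced S c l \<gamma>)"

definition optimal_S where
  "optimal_S S c l \<gamma> \<longleftrightarrow> (\<forall>c' l' \<gamma>'. perf_S S c l \<gamma> \<le> perf_S S c' l' \<gamma>')"


subsection \<open>Belief updates\<close>

text \<open>
  Bayes update after the channel output \<open>y\<close>.  If \<open>y\<close> has probability zero under \<open>p\<close>, there is
  nothing to normalise, and \<open>p\<close> is kept by convention; this does not happen to true beliefs.
\<close>

definition bayes_weight ::
    "('x, 'w, 'm, 'z, 'n, 'y, 'u) feedback_system \<Rightarrow> ('x \<times> 'm \<Rightarrow> 'z) \<Rightarrow> ('x, 'm) belief \<Rightarrow> 'y \<Rightarrow>
     'x \<times> 'm \<Rightarrow> real" where
  "bayes_weight S c p y xm =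
     pmf p xm * measure_pmf.prob (law_N S) {n. channel S (c xm) n = y}"

definition bayes ::
    "('x::finite, 'w, 'm::finite, 'z, 'n, 'y, 'u) feedback_system \<Rightarrow> ('x \<times> 'm \<Rightarrow> 'z) \<Rightarrow>
     ('x, 'm) belief \<Rightarrow> 'y \<Rightarrow> ('x, 'm) belief" where
  "bayes S c p y =
     (let Z = (\<Sum>xm\<in>UNIV. bayes_weight S c p y xm)
      in if Z = 0 then p else embed_pmf (\<lambda>xm. bayes_weight S c p y xm / Z))"

lemma pmf_bayes:
  assumes "(\<Sum>xm\<in>UNIV. bayes_weight S c p y xm) \<noteq> 0"
  shows "pmf (bayes S c p y) xm =
           bayes_weight S c p y xm / (\<Sum>xm\<in>UNIV. bayes_weight S c p y xm)"
proof -
  let ?Z = "\<Sum>xm\<in>UNIV. bayes_weight S c p y xm"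
  have nn: "bayes_weight S c p y a \<ge> 0" for a by (simp add: bayes_weight_def)
  then have Z: "?Z \<ge> 0" by (intro sum_nonneg)
  have "(\<integral>\<^sup>+ a. ennreal (bayes_weight S c p y a / ?Z) \<partial>count_space UNIV) =
        (\<Sum>a\<in>UNIV. ennreal (bayes_weight S c p y a / ?Z))"
    by (subst nn_integral_count_space_finite) auto
  also have "\<dots> = ennreal (\<Sum>a\<in>UNIV. bayes_weight S c p y a / ?Z)"
    by (rule sum_ennreal) (use nn Z in auto)
  also have "(\<Sum>a\<in>UNIV. bayes_weight S c p y a / ?Z) = 1"
    using assms by (simp flip: sum_divide_distrib)
  finally show ?thesis
    using assms nn Z by (simp add: bayes_def Let_def pmf_embed_pmf)
qed

definition memory_update :: "('x \<times> 'm \<Rightarrow> 'm) \<Rightarrow> ('x, 'm) belief \<Rightarrow> ('x, 'm) belief" where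
  "memory_update l p = map_pmf (\<lambda>(x, m). (x, l (x, m))) p"

lemma pmf_memory_update:
  fixes p :: "('x, 'm::finite) belief"
  shows "pmf (memory_update l p) (x', m') =
           (\<Sum>m''\<in>UNIV. pmf p (x', m'') * of_bool (m' = l (x', m'')))"
proof -
  have "(\<lambda>(x, m). (x, l (x, m))) -` {(x', m')} = Pair x' ` {m''. m' = l (x', m'')}"
    by auto
  then have "pmf (memory_update l p) (x', m') =
      measure_pmf.prob p (Pair x' ` {m''. m' = l (x', m'')})"
    by (simp add: memory_update_def pmf_map)
  also have "\<dots> = (\<Sum>m'' | m' = l (x', m''). pmf p (x', m''))"
    by (subst measure_measure_pmf_finite) (simp_all add: sum.reindex inj_on_def)
  also have "\<dots> = (\<Sum>m''\<in>UNIV. pmf p (x', m'') * of_bool (m' = l (x', m'')))"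
    by (rule sum.mono_neutral_cong_left) auto
  finally show ?thesis .
qed

definition state_update ::
    "('x, 'w, 'm, 'z, 'n, 'y, 'u) feedback_system \<Rightarrow> 'u \<Rightarrow> ('x, 'm) belief \<Rightarrow> ('x, 'm) belief" where
  "state_update S u p =
     bind_pmf p (\<lambda>(x, m). map_pmf (\<lambda>w. (plant S x u w, m)) (law_W S))"

lemma pmf_state_update:
  fixes S :: "('x::finite, 'w, 'm::finite, 'z, 'n, 'y, 'u) feedback_system"
  shows "pmf (state_update S u p) (x', m') =
           (\<Sum>x\<in>UNIV. pmf p (x, m') * measure_pmf.prob (law_W S) {w. plant S x u w = x'})"
proof -
  have *: "pmf (map_pmf (\<lambda>w. (plant S x u w, m)) (law_W S)) (x', m') =
      (if m = m' then measure_pmf.prob (law_W S) {w. plant S x u w = x'} else 0)" for x m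
    by (auto simp: pmf_map vimage_def)
  have "pmf (state_update S u p) (x', m') =
      (\<Sum>(x, m)\<in>UNIV. pmf p (x, m) *
        (if m = m' then measure_pmf.prob (law_W S) {w. plant S x u w = x'} else 0))"
    unfolding state_update_def pmf_bind
    by (subst integral_measure_pmf[of UNIV]) (auto simp: * case_prod_beta intro!: sum.cong)
  also have "\<dots> = (\<Sum>x\<in>UNIV. \<Sum>m\<in>UNIV. pmf p (x, m) *
        (if m = m' then measure_pmf.prob (law_W S) {w. plant S x u w = x'} else 0))"
    by (simp add: sum.cartesian_product UNIV_Times_UNIV)
  also have "\<dots> = (\<Sum>x\<in>UNIV. pmf p (x, m') * measure_pmf.prob (law_W S) {w. plant S x u w = x'})"
    by (intro sum.cong refl) (simp add: if_distrib cong: if_cong)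
  finally show ?thesis .
qed


subsection \<open>The deterministic problem on information states\<close>

text \<open>
  Belief controllers are arbitrary functions on the uncountable set of beliefs, without any
  measurability requirement.  Information states are therefore discrete probability measures, for
  which every such function has a law and an expectation; they contain the initial information
  state and are closed under the three transformations.
\<close>

type_synonym ('x, 'm) info = "('x \<times> 'm \<times> ('x, 'm) belief) pmf"

definition Qc ::
    "('x::finite, 'w, 'm::finite, 'z, 'n, 'y, 'u) feedback_system \<Rightarrow> ('x \<times> 'm \<Rightarrow> 'z) \<Rightarrow>
     ('x, 'm) info \<Rightarrow> ('x, 'm) info" where
  "Qc S c \<pi> =
     bind_pmf \<pi> (\<lambda>(x, m, p).
       map_pmf (\<lambda>n. (x, m, bayes S c p (channel S (c (x, m)) n))) (law_N S))"

definition Ql :: "('x \<times> 'm \<Rightarrow> 'm) \<Rightarrow> ('x, 'm) info \<Rightarrow> ('x, 'm) info" where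
  "Ql l \<pi> = map_pmf (\<lambda>(x, m, p). (x, l (x, m), memory_update l p)) \<pi>"

definition Qg ::
    "('x, 'w, 'm, 'z, 'n, 'y, 'u) feedback_system \<Rightarrow> (('x, 'm) belief \<Rightarrow> 'u) \<Rightarrow>
     ('x, 'm) info \<Rightarrow> ('x, 'm) info" where
  "Qg S \<gamma> \<pi> =
     bind_pmf \<pi> (\<lambda>(x, m, p).
       map_pmf (\<lambda>w. (plant S x (\<gamma> p) w, m, state_update S (\<gamma> p) p)) (law_W S))"

definition info_cost ::
    "('x, 'w, 'm, 'z, 'n, 'y, 'u) feedback_system \<Rightarrow> ('x, 'm) info \<Rightarrow>
     (('x, 'm) belief \<Rightarrow> 'u) \<Rightarrow> real" where
  "info_cost S \<pi> \<gamma> = measure_pmf.expectation \<pi> (\<lambda>(x, m, p). cost S x (\<gamma> p))"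

text \<open>
  Before the first channel output there is nothing to condition on, so the initial belief is the
  prior law of the initial state and memory content.
\<close>

definition info_init :: "('x, 'w, 'm, 'z, 'n, 'y, 'u) feedback_system \<Rightarrow> ('x, 'm) info" where
  "info_init S =
     map_pmf (\<lambda>x. (x, mem0 S, pair_pmf (law_X1 S) (return_pmf (mem0 S)))) (law_X1 S)"

fun pi_c ::
    "('x::finite, 'w, 'm::finite, 'z, 'n, 'y, 'u) feedback_system \<Rightarrow> ('x, 'm, 'z) encoders \<Rightarrow>
     ('x, 'm) updates \<Rightarrow> ('x, 'm, 'u) belief_controllers \<Rightarrow> nat \<Rightarrow> ('x, 'm) info"
and pi_l ::
    "('x::finite, 'w, 'm::finite, 'z, 'n, 'y, 'u) feedback_system \<Rightarrow> ('x, 'm, 'z) encoders \<Rightarrow>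
     ('x, 'm) updates \<Rightarrow> ('x, 'm, 'u) belief_controllers \<Rightarrow> nat \<Rightarrow> ('x, 'm) info"
and pi_g ::
    "('x::finite, 'w, 'm::finite, 'z, 'n, 'y, 'u) feedback_system \<Rightarrow> ('x, 'm, 'z) encoders \<Rightarrow>
     ('x, 'm) updates \<Rightarrow> ('x, 'm, 'u) belief_controllers \<Rightarrow> nat \<Rightarrow> ('x, 'm) info"
where
  "pi_c S c l \<gamma> t =
     (if t \<le> 1 then info_init S else Qg S (\<gamma> (t - 1)) (pi_g S c l \<gamma> (t - 1)))"
| "pi_l S c l \<gamma> t = Qc S (c t) (pi_c S c l \<gamma> t)"
| "pi_g S c l \<gamma> t = Ql (l t) (pi_l S c l \<gamma> t)"

declare pi_c.simps [simp del] pi_l.simps [simp del] pi_g.simps [simp del]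

definition perf_D where
  "perf_D S c l \<gamma> = (\<Sum>t = 1..horizon S. info_cost S (pi_g S c l \<gamma> t) (\<gamma> t))"

definition optimal_D where
  "optimal_D S c l \<gamma> \<longleftrightarrow> (\<forall>c' l' \<gamma>'. perf_D S c l \<gamma> \<le> perf_D S c' l' \<gamma>')"


subsection \<open>Nested optimality equations\<close>

function Vc ::
    "('x::finite, 'w, 'm::finite, 'z::finite, 'n, 'y, 'u) feedback_system \<Rightarrow> nat \<Rightarrow>
     ('x, 'm) info \<Rightarrow> real"
and Vl ::
    "('x::finite, 'w, 'm::finite, 'z::finite, 'n, 'y, 'u) feedback_system \<Rightarrow> nat \<Rightarrow>
     ('x, 'm) info \<Rightarrow> real"
and Vg ::
    "('x::finite, 'w, 'm::finite, 'z::finite, 'n, 'y, 'u) feedback_system \<Rightarrow> nat \<Rightarrow>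
     ('x, 'm) info \<Rightarrow> real"
where
  "Vc S t \<pi> = (MIN c. Vl S t (Qc S c \<pi>))"
| "Vl S t \<pi> = (MIN l. Vg S t (Ql l \<pi>))"
| "Vg S t \<pi> =
     (if t < horizon S
      then (INF \<gamma>. info_cost S \<pi> \<gamma> + Vc S (t + 1) (Qg S \<gamma> \<pi>))
      else (INF \<gamma>. info_cost S \<pi> \<gamma>))"
  by pat_completeness auto
termination
  by (relation "Wellfounded.measure (\<lambda>a. case a of
        Inl (S, t, _) \<Rightarrow> 3 * (horizon S + 1 - t) + 2
      | Inr (Inl (S, t, _)) \<Rightarrow> 3 * (horizon S + 1 - t) + 1
      | Inr (Inr (S, t, _)) \<Rightarrow> 3 * (horizon S + 1 - t))") auto

declare Vc.simps [simp del] Vl.simps [simp del] Vg.simps [simp del]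

text \<open>The expression that is minimised over \<open>\<gamma>\<close> in the equation for \<^const>\<open>Vg\<close>.\<close>

definition Vg_arg where
  "Vg_arg S t \<pi> \<gamma> =
     info_cost S \<pi> \<gamma> + (if t < horizon S then Vc S (t + 1) (Qg S \<gamma> \<pi>) else 0)"

lemma Vg_eq_INF: "Vg S t \<pi> = (INF \<gamma>. Vg_arg S t \<pi> \<gamma>)"
  by (simp add: Vg.simps Vg_arg_def)

text \<open>
  A design given by the nested equations: at every stage its rules attain the minima at the
  information states that it generates itself.
\<close>

definition nested_optimal ::
    "('x::finite, 'w, 'm::finite, 'z::finite, 'n, 'y, 'u) feedback_system \<Rightarrow>
     ('x, 'm, 'z) encoders \<Rightarrow> ('x, 'm) updates \<Rightarrow> ('x, 'm, 'u) belief_controllers \<Rightarrow> bool" where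
  "nested_optimal S c l \<gamma> \<longleftrightarrow>
     (\<forall>t\<in>{1..horizon S}.
        is_arg_min (\<lambda>c'. Vl S t (Qc S c' (pi_c S c l \<gamma> t))) (\<lambda>_. True) (c t) \<and>
        is_arg_min (\<lambda>l'. Vg S t (Ql l' (pi_l S c l \<gamma> t))) (\<lambda>_. True) (l t) \<and>
        is_arg_min (\<lambda>\<gamma>'. Vg_arg S t (pi_g S c l \<gamma> t) \<gamma>') (\<lambda>_. True) (\<gamma> t))"

end

theory Submission
  imports Defs
begin

text \<open>
  The Bayes filter gives the joint law of the belief and the controller's data, under which the true
  state and memory content are distributed according to the belief.  So the laws \<open>\<pi>\<close> of the
  deterministic problem are those of the stochastic system, and (D) and (S) have the same cost.
  For a fixed encoder and memory, dynamic programming on beliefs yields a belief controller at least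
  as good as every history-dependent one; hence the bound \<^term>\<open>Vc S 1 (info_init S)\<close> for (D), which
  telescopes along the nested equations, is a bound for (B) as well.  Minimisers exist because all
  reachable information states have finite support.
\<close>

section \<open>Expectations and conditioning for discrete laws\<close>

lemma expectation_bind_pmf_finite:
  fixes h :: "'b \<Rightarrow> real"
  assumes "finite (set_pmf p)" "\<And>x. x \<in> set_pmf p \<Longrightarrow> finite (set_pmf (f x))"
  shows "measure_pmf.expectation (bind_pmf p f) h =
         measure_pmf.expectation p (\<lambda>x. measure_pmf.expectation (f x) h)"
  using assms
  by (subst pmf_expectation_bind[of "set_pmf p"])
     (auto simp: integral_measure_pmf_real[of "set_pmf p"] mult.commute intro!: sum.cong)

lemma expectation_cong_pmf:
  fixes f :: "'a \<Rightarrow> real"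
  assumes "\<And>x. x \<in> set_pmf p \<Longrightarrow> f x = g x"
  shows "measure_pmf.expectation p f = measure_pmf.expectation p g"
  by (rule integral_cong_AE) (use assms in \<open>auto simp: AE_measure_pmf_iff\<close>)

lemma expectation_mono_pmf:
  fixes f :: "'a \<Rightarrow> real"
  assumes "finite (set_pmf p)" "\<And>x. x \<in> set_pmf p \<Longrightarrow> f x \<le> g x"
  shows "measure_pmf.expectation p f \<le> measure_pmf.expectation p g"
  by (rule integral_mono_AE)
     (use assms in \<open>auto simp: AE_measure_pmf_iff intro: integrable_measure_pmf_finite\<close>)

lemma pmf_map_pair_left:
  "pmf (map_pmf (\<lambda>a. (a, i)) p) (a', i') = (if i = i' then pmf p a' else 0)"
proof -
  have "(\<lambda>a. (a, i)) -` {(a', i')} = (if i = i' then {a'} else {})" by auto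
  then show ?thesis by (simp add: pmf_map measure_pmf_single)
qed

text \<open>By injectivity \<open>(b, i)\<close> is the only point in the support of
  \<open>h\<close> with second component \<open>i\<close>. The joint mass at \<open>(a, i)\<close>
  thus factors as \<open>pmf h (b, i) * pmf b a\<close>, and conditioning divides out the first
  factor.\<close>

lemma cond_pmf_disintegration:
  assumes inj: "inj_on snd (set_pmf h)" and mem: "(b, i) \<in> set_pmf h"
  shows "map_pmf fst (cond_pmf (bind_pmf h (\<lambda>(b, i). map_pmf (\<lambda>a. (a, i)) b)) (snd -` {i})) = b"
proof -
  let ?J = "bind_pmf h (\<lambda>(b, i). map_pmf (\<lambda>a. (a, i)) b)"
  have eq: "b' = b" if "(b', i) \<in> set_pmf h" for b'
    using inj_onD[OF inj _ that mem] by simp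
  have pJ: "pmf ?J (a, i) = pmf h (b, i) * pmf b a" for a
  proof -
    have "pmf ?J (a, i) = measure_pmf.expectation h (\<lambda>z. indicator {(b, i)} z * pmf b a)"
      unfolding pmf_bind
      by (rule expectation_cong_pmf)
         (auto simp: pmf_map_pair_left indicator_def dest: eq split: prod.splits)
    then show ?thesis by (simp add: measure_pmf_single)
  qed
  have "map_pmf snd ?J = map_pmf snd h"
    by (simp add: map_bind_pmf pmf.map_comp o_def case_prod_beta map_pmf_const)
       (simp add: map_pmf_def)
  then have "measure_pmf.prob ?J (snd -` {i}) = pmf (map_pmf snd h) i"
    by (metis pmf_map)
  also have "\<dots> = pmf h (b, i)"
    using pmf_map_inj[OF inj mem] by simp
  finally have prob: "measure_pmf.prob ?J (snd -` {i}) = pmf h (b, i)" .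
  have pos: "pmf h (b, i) \<noteq> 0" using mem by (simp add: set_pmf_iff)
  obtain a0 where "a0 \<in> set_pmf b" using set_pmf_not_empty by fast
  then have ne: "set_pmf ?J \<inter> snd -` {i} \<noteq> {}"
    using mem by force
  show ?thesis
  proof (rule pmf_eqI)
    fix a
    have "pmf (map_pmf fst (cond_pmf ?J (snd -` {i}))) a =
          measure_pmf.prob (cond_pmf ?J (snd -` {i})) (fst -` {a})"
      by (simp add: pmf_map)
    also have "\<dots> = measure_pmf.prob (cond_pmf ?J (snd -` {i})) {(a, i)}"
      by (rule measure_prob_cong_0) (auto simp: pmf_cond[OF ne])
    also have "\<dots> = pmf b a"
      using pos by (simp add: measure_pmf_single pmf_cond[OF ne] pJ prob)
    finally show "pmf (map_pmf fst (cond_pmf ?J (snd -` {i}))) a = pmf b a" .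
  qed
qed

section \<open>Independence of the past from the next disturbance and noise\<close>

text \<open>Resetting later coordinates to \<open>d\<close> makes a truncated sequence a point of
  the smaller product law. Coordinates beyond \<open>Suc k\<close> are dropped first, then
  \<open>Pi_pmf_insert\<close> peels off the last one.\<close>

lemma Pi_pmf_split_last:
  assumes "Suc k \<le> T"
  shows "map_pmf (\<lambda>f. (\<lambda>i. if i \<in> {1..k} then f i else d, f (Suc k))) (Pi_pmf {1..T} d (\<lambda>_. p)) =
         pair_pmf (Pi_pmf {1..k} d (\<lambda>_. p)) p"
proof -
  let ?r = "\<lambda>A f i. if i \<in> A then f i else d"
  have "map_pmf (\<lambda>f. (?r {1..k} f, f (Suc k))) (Pi_pmf {1..T} d (\<lambda>_. p)) =
        map_pmf (\<lambda>f. (?r {1..k} f, f (Suc k))) (map_pmf (?r {1..Suc k}) (Pi_pmf {1..T} d (\<lambda>_. p)))"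
    unfolding pmf.map_comp o_def by (intro map_pmf_cong refl) auto
  also have "map_pmf (?r {1..Suc k}) (Pi_pmf {1..T} d (\<lambda>_. p)) = Pi_pmf {1..Suc k} d (\<lambda>_. p)"
    by (rule Pi_pmf_subset[symmetric]) (use assms in auto)
  also have "\<dots> = map_pmf (\<lambda>(y, f). f(Suc k := y)) (pair_pmf p (Pi_pmf {1..k} d (\<lambda>_. p)))"
    using Pi_pmf_insert[of "{1..k}" "Suc k" d "\<lambda>_. p"] by (simp add: atLeastAtMostSuc_conv)
  also have "map_pmf (\<lambda>f. (?r {1..k} f, f (Suc k))) \<dots> =
      map_pmf (\<lambda>(y, f). (f, y)) (pair_pmf p (Pi_pmf {1..k} d (\<lambda>_. p)))"
    unfolding pmf.map_comp
    by (rule map_pmf_cong) (auto simp: fun_eq_iff set_Pi_pmf PiE_dflt_def)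
  also have "\<dots> = pair_pmf (Pi_pmf {1..k} d (\<lambda>_. p)) p"
    by (subst (2) pair_commute_pmf) (simp add: case_prod_beta)
  finally show ?thesis .
qed

lemma run_coordinates_cong:
  assumes "\<And>i. 1 \<le> i \<Longrightarrow> i \<le> k \<Longrightarrow> w i = w' i \<and> n i = n' i"
  shows "run S c l g (x, w, n) k = run S c l g (x, w', n') k"
  using assms by (induction k) (auto split: prod.splits)

text \<open>Moves the split into past and next coordinate inside each factor, where
  \<open>Pi_pmf_split_last\<close> applies.\<close>

lemma pair_pmf_map_both:
  "map_pmf (\<lambda>(a, b, e). (F a (f b) (f' e), h b, h' e)) (pair_pmf A (pair_pmf B E)) =
   map_pmf (\<lambda>(a, (r, s), (r', s')). (F a r r', s, s'))
     (pair_pmf A (pair_pmf (map_pmf (\<lambda>b. (f b, h b)) B) (map_pmf (\<lambda>e. (f' e, h' e)) E)))"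
  by (simp add: pair_map_pmf1 pair_map_pmf2 pmf.map_comp o_def case_prod_unfold)

text \<open>The first \<open>k\<close> stages read only the coordinates up to \<open>k\<close>,
  which are independent of those at \<open>Suc k\<close>.\<close>

lemma run_independent_of_next:
  assumes "Suc k \<le> horizon S"
  shows "map_pmf (\<lambda>\<omega>. (run S c l g \<omega> k, fst (snd \<omega>) (Suc k), snd (snd \<omega>) (Suc k))) (sample_law S) =
         pair_pmf (map_pmf (\<lambda>\<omega>. run S c l g \<omega> k) (sample_law S)) (pair_pmf (law_W S) (law_N S))"
proof -
  let ?r = "\<lambda>f i. if i \<in> {1..k} then f i else undefined"
  let ?PW = "Pi_pmf {1..horizon S} undefined (\<lambda>_. law_W S)"
  let ?PN = "Pi_pmf {1..horizon S} undefined (\<lambda>_. law_N S)"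
  let ?F = "\<lambda>x w n. run S c l g (x, w, n) k"
  have r: "run S c l g \<omega> k = ?F (fst \<omega>) (?r (fst (snd \<omega>))) (?r (snd (snd \<omega>)))" for \<omega>
    by (cases \<omega>) (auto intro: run_coordinates_cong)
  have "map_pmf (\<lambda>\<omega>. (run S c l g \<omega> k, fst (snd \<omega>) (Suc k), snd (snd \<omega>) (Suc k))) (sample_law S) =
        map_pmf (\<lambda>(x, w, n). (?F x (?r w) (?r n), w (Suc k), n (Suc k))) (sample_law S)"
    by (subst r) (simp add: case_prod_unfold)
  also have "\<dots> = map_pmf (\<lambda>(a, (r, s), (r', s')). (?F a r r', s, s'))
     (pair_pmf (law_X1 S)
       (pair_pmf (pair_pmf (Pi_pmf {1..k} undefined (\<lambda>_. law_W S)) (law_W S))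
                 (pair_pmf (Pi_pmf {1..k} undefined (\<lambda>_. law_N S)) (law_N S))))"
    unfolding sample_law_def
    by (subst pair_pmf_map_both[of ?F ?r ?r "\<lambda>w. w (Suc k)" "\<lambda>n. n (Suc k)"])
       (simp only: Pi_pmf_split_last[OF assms])
  finally have main: "map_pmf (\<lambda>\<omega>. (run S c l g \<omega> k, fst (snd \<omega>) (Suc k), snd (snd \<omega>) (Suc k))) (sample_law S) =
     map_pmf (\<lambda>(a, (r, s), (r', s')). (?F a r r', s, s'))
     (pair_pmf (law_X1 S)
       (pair_pmf (pair_pmf (Pi_pmf {1..k} undefined (\<lambda>_. law_W S)) (law_W S))
                 (pair_pmf (Pi_pmf {1..k} undefined (\<lambda>_. law_N S)) (law_N S))))" .
  define R where "R = map_pmf (\<lambda>(a, r, r'). ?F a r r')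
     (pair_pmf (law_X1 S) (pair_pmf (Pi_pmf {1..k} undefined (\<lambda>_. law_W S))
                 (Pi_pmf {1..k} undefined (\<lambda>_. law_N S))))"
  have joint: "map_pmf (\<lambda>\<omega>. (run S c l g \<omega> k, fst (snd \<omega>) (Suc k), snd (snd \<omega>) (Suc k))) (sample_law S) =
     pair_pmf R (pair_pmf (law_W S) (law_N S))"
    unfolding main R_def
    by (simp add: pair_pmf_def map_pmf_def bind_assoc_pmf bind_return_pmf
        bind_commute_pmf[of "law_W S" "Pi_pmf {Suc 0..k} undefined (\<lambda>_. law_N S)"])
  from arg_cong[OF this, of "map_pmf fst"]
  have "map_pmf (\<lambda>\<omega>. run S c l g \<omega> k) (sample_law S) = R"
    by (simp add: pmf.map_comp o_def map_fst_pair_pmf)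
  with joint show ?thesis by simp
qed

section \<open>The Bayes filter and the law of the system\<close>

definition output_law ::
    "('x, 'w, 'm, 'z, 'n, 'y, 'u) feedback_system \<Rightarrow> ('x \<times> 'm \<Rightarrow> 'z) \<Rightarrow> ('x, 'm) belief \<Rightarrow> 'y pmf" where
  "output_law S c b = bind_pmf b (\<lambda>xm. map_pmf (channel S (c xm)) (law_N S))"

lemma bayes_weight_nonneg: "0 \<le> bayes_weight S c b y xm"
  by (simp add: bayes_weight_def)

text \<open>The normalising constant of \<open>bayes\<close> is thus the predicted probability of
  the output.\<close>

lemma pmf_output_law:
  fixes S :: "('x::finite, 'w, 'm::finite, 'z, 'n, 'y, 'u) feedback_system"
  shows "pmf (output_law S c b) y = (\<Sum>xm\<in>UNIV. bayes_weight S c b y xm)"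
  by (simp add: output_law_def pmf_bind integral_measure_pmf_real[of UNIV] bayes_weight_def
      pmf_map vimage_def mult.commute)

text \<open>Both sides put mass \<open>bayes_weight\<close> on a point: multiplying the posterior by
  the output probability cancels the normalisation. In this form the Bayes rule composes with
  \<open>bind_pmf\<close>.\<close>

lemma bayes_disintegration:
  fixes S :: "('x::finite, 'w, 'm::finite, 'z, 'n, 'y, 'u) feedback_system"
  shows "bind_pmf b (\<lambda>xm. map_pmf (\<lambda>n. (xm, channel S (c xm) n)) (law_N S)) =
         bind_pmf (output_law S c b) (\<lambda>y. map_pmf (\<lambda>xm. (xm, y)) (bayes S c b y))"
    (is "?L = ?R")
proof (rule pmf_eqI)
  fix a :: "('x \<times> 'm) \<times> 'y"
  obtain xm y where a: "a = (xm, y)" by (cases a)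
  have *: "pmf (map_pmf (\<lambda>n. (xm', channel S (c xm') n)) (law_N S)) (xm, y) =
     (if xm' = xm then measure_pmf.prob (law_N S) {n. channel S (c xm) n = y} else 0)" for xm'
    by (auto simp: pmf_map vimage_def)
  have L: "pmf ?L a = bayes_weight S c b y xm"
    unfolding a pmf_bind *
    by (simp add: integral_measure_pmf_real[of UNIV] bayes_weight_def if_distrib if_distribR
        cong: if_cong) 
  have "pmf ?R a = measure_pmf.expectation (output_law S c b)
      (\<lambda>y'. indicator {y} y' * pmf (bayes S c b y) xm)"
    unfolding a pmf_bind
    by (rule expectation_cong_pmf) (auto simp: pmf_map_pair_left indicator_def)
  also have "\<dots> = (\<Sum>xm\<in>UNIV. bayes_weight S c b y xm) * pmf (bayes S c b y) xm"
    by (simp add: measure_pmf_single pmf_output_law)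
  also have "\<dots> = bayes_weight S c b y xm"
  proof (cases "(\<Sum>xm\<in>UNIV. bayes_weight S c b y xm) = 0")
    \<comment> \<open>The output has probability zero: the conventional value of
      \<open>bayes\<close> is multiplied by zero, and each nonnegative weight vanishes with the
      sum.\<close>
    case True
    then have "bayes_weight S c b y xm = 0"
      by (cases xm) (simp add: sum_nonneg_eq_0_iff bayes_weight_nonneg)
    with True show ?thesis by simp
  next
    case False
    then show ?thesis by (simp add: pmf_bayes)
  qed
  finally show "pmf ?L a = pmf ?R a" using L by simp
qed

text \<open>Stage \<open>Suc k\<close> of the Bayes filter is split at the moment when the controller acts.\<close>

definition observe ::
    "('x::finite, 'w, 'm::finite, 'z, 'n, 'y, 'u) feedback_system \<Rightarrow> ('x \<times> 'm \<Rightarrow> 'z) \<Rightarrow>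
     ('x \<times> 'm \<Rightarrow> 'm) \<Rightarrow> (('x, 'm) belief \<times> 'y list \<times> 'u list) pmf \<Rightarrow>
     (('x, 'm) belief \<times> 'y list \<times> 'u list) pmf" where
  "observe S c l h = bind_pmf h (\<lambda>(b, ys, us).
     map_pmf (\<lambda>y. (memory_update l (bayes S c b y), ys @ [y], us)) (output_law S c b))"

definition act ::
    "('x, 'w, 'm, 'z, 'n, 'y, 'u) feedback_system \<Rightarrow> ('y list \<Rightarrow> 'u list \<Rightarrow> 'u) \<Rightarrow>
     (('x, 'm) belief \<times> 'y list \<times> 'u list) pmf \<Rightarrow>
     (('x, 'm) belief \<times> 'y list \<times> 'u list) pmf" where
  "act S g h = map_pmf (\<lambda>(b, ys, us). (state_update S (g ys us) b, ys, us @ [g ys us])) h"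

definition prior ::
    "('x, 'w, 'm, 'z, 'n, 'y, 'u) feedback_system \<Rightarrow> ('x, 'm) belief" where
  "prior S = pair_pmf (law_X1 S) (return_pmf (mem0 S))"

text \<open>The filter runs without a plant: outputs are drawn from the law predicted by the current
  belief. The history is carried along for the controller, and \<open>draw_state\<close> puts the
  hidden state back.\<close>

primrec filter_law ::
    "('x::finite, 'w, 'm::finite, 'z, 'n, 'y, 'u) feedback_system \<Rightarrow> ('x, 'm, 'z) encoders \<Rightarrow>
     ('x, 'm) updates \<Rightarrow> ('y, 'u) controllers \<Rightarrow> nat \<Rightarrow>
     (('x, 'm) belief \<times> 'y list \<times> 'u list) pmf" where
  "filter_law S c l g 0 = return_pmf (prior S, [], [])"
| "filter_law S c l g (Suc k) =
     act S (g (Suc k)) (observe S (c (Suc k)) (l (Suc k)) (filter_law S c l g k))"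

definition draw_state :: "(('x, 'm) belief \<times> 'i) pmf \<Rightarrow> (('x \<times> 'm) \<times> 'i) pmf" where
  "draw_state h = bind_pmf h (\<lambda>(b, i). map_pmf (\<lambda>xm. (xm, i)) b)"

definition run_state where
  "run_state S c l g \<omega> k = (case run S c l g \<omega> k of (x, m, i) \<Rightarrow> ((x, m), i))"

text \<open>The snapshot between channel output and control: the memory content is already new, the
  plant state and the controls are still old.\<close>

definition decision_state where
  "decision_state S c l g \<omega> t =
     ((X_at S c l g \<omega> t, M_at S c l g \<omega> t), outputs S c l g \<omega> t, controls S c l g \<omega> (t - 1))"

text \<open>With \<open>run_state_Suc\<close> this cuts a stage into two halves, the first driven by
  the noise alone, the second by the disturbance alone.\<close>

lemma decision_state_Suc:
  "decision_state S c l g \<omega> (Suc k) =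
     (\<lambda>((xm, ys, us), n). ((fst xm, l (Suc k) xm), ys @ [channel S (c (Suc k) xm) n], us))
       (run_state S c l g \<omega> k, snd (snd \<omega>) (Suc k))"
  by (simp add: decision_state_def run_state_def X_at_def M_at_def outputs_def controls_def Let_def
      split: prod.splits)

lemma run_state_Suc:
  "run_state S c l g \<omega> (Suc k) =
     (\<lambda>(((x, m), ys, us), w). ((plant S x (g (Suc k) ys us) w, m), ys, us @ [g (Suc k) ys us]))
       (decision_state S c l g \<omega> (Suc k), fst (snd \<omega>) (Suc k))"
  by (simp add: decision_state_def run_state_def X_at_def M_at_def outputs_def controls_def Let_def
      split: prod.splits)

lemma run_state_independent_of_next:
  assumes "Suc k \<le> horizon S"
  shows "map_pmf (\<lambda>\<omega>. (run_state S c l g \<omega> k, fst (snd \<omega>) (Suc k), snd (snd \<omega>) (Suc k))) (sample_law S) =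
         pair_pmf (map_pmf (\<lambda>\<omega>. run_state S c l g \<omega> k) (sample_law S)) (pair_pmf (law_W S) (law_N S))"
  using arg_cong[OF run_independent_of_next[OF assms, of c l g],
      of "map_pmf (\<lambda>((x, m, i), j). (((x, m), i), j))"]
  by (simp add: pmf.map_comp o_def case_prod_unfold run_state_def pair_map_pmf1
      apfst_def map_prod_def)

text \<open>The snapshot uses past data and the current noise, so the disturbance of the same stage
  is still fresh.\<close>

lemma decision_state_independent_of_next:
  fixes S :: "('x, 'w, 'm, 'z, 'n, 'y, 'u) feedback_system"
  assumes "Suc k \<le> horizon S"
  shows "map_pmf (\<lambda>\<omega>. (decision_state S c l g \<omega> (Suc k), fst (snd \<omega>) (Suc k))) (sample_law S) =
         pair_pmf (map_pmf (\<lambda>\<omega>. decision_state S c l g \<omega> (Suc k)) (sample_law S)) (law_W S)"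
    (is "?L = pair_pmf ?M _")
proof -
  let ?J = "map_pmf (\<lambda>\<omega>. run_state S c l g \<omega> k) (sample_law S)"
  define F where "F = (\<lambda>((xm, ys, us), n). ((fst xm, l (Suc k) xm), ys @ [channel S (c (Suc k) xm) n], us :: 'u list))"
  have d: "decision_state S c l g \<omega> (Suc k) = F (run_state S c l g \<omega> k, snd (snd \<omega>) (Suc k))" for \<omega>
    unfolding F_def by (rule decision_state_Suc)
  have "?L = map_pmf (\<lambda>(a, w, n). (F (a, n), w)) (pair_pmf ?J (pair_pmf (law_W S) (law_N S)))"
    by (subst run_state_independent_of_next[OF assms, symmetric])
       (simp add: pmf.map_comp o_def case_prod_unfold d)
  also have "\<dots> = pair_pmf (map_pmf F (pair_pmf ?J (law_N S))) (law_W S)"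
    by (simp add: pair_pmf_def map_pmf_def bind_assoc_pmf bind_return_pmf
        bind_commute_pmf[of "law_W S" "law_N S"])
  finally have *: "?L = pair_pmf (map_pmf F (pair_pmf ?J (law_N S))) (law_W S)" .
  from arg_cong[OF this, of "map_pmf fst"] have "?M = map_pmf F (pair_pmf ?J (law_N S))"
    by (simp add: pmf.map_comp o_def map_fst_pair_pmf)
  with * show ?thesis by simp
qed

text \<open>The system draws the state and then the output, the filter the output and then the state
  from the posterior; \<open>bayes_disintegration\<close> exchanges the two orders.\<close>

lemma draw_state_observe:
  fixes h :: "(('x::finite, 'm::finite) belief \<times> 'y list \<times> 'u list) pmf"
  shows "draw_state (observe S c l h) =
   map_pmf (\<lambda>((xm, ys, us), n). ((fst xm, l xm), ys @ [channel S (c xm) n], us))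
     (pair_pmf (draw_state h) (law_N S))"
proof -
  have *: "bind_pmf b (\<lambda>xm. map_pmf (\<lambda>n. ((fst xm, l xm), ys @ [channel S (c xm) n], us)) (law_N S)) =
        bind_pmf (output_law S c b) (\<lambda>y. map_pmf (\<lambda>xm. (xm, ys @ [y], us)) (memory_update l (bayes S c b y)))"
    for b and ys and us :: "'f list"
    using arg_cong[OF bayes_disintegration[of b S c], of "map_pmf (\<lambda>(xm, y). ((fst xm, l xm), ys @ [y], us))"]
    by (simp add: map_bind_pmf pmf.map_comp o_def memory_update_def case_prod_unfold)
  show ?thesis
    by (simp add: draw_state_def observe_def pair_pmf_def bind_assoc_pmf bind_map_pmf map_bind_pmf
        case_prod_unfold bind_return_pmf pmf.map_comp o_def * flip: map_pmf_def)
qed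

lemma draw_state_act:
  "draw_state (act S g h) =
   map_pmf (\<lambda>(((x, m), ys, us), w). ((plant S x (g ys us) w, m), ys, us @ [g ys us]))
     (pair_pmf (draw_state h) (law_W S))"
  by (simp add: draw_state_def act_def pair_pmf_def bind_assoc_pmf bind_map_pmf map_bind_pmf
      case_prod_unfold bind_return_pmf state_update_def map_pmf_def)

text \<open>The law at the start of the stage is assumed here because the induction for
  \<open>law_run_state\<close> passes through this half stage; \<open>law_decision_state\<close>
  discharges it afterwards.\<close>

lemma law_decision_state_step:
  assumes "Suc k \<le> horizon S"
    and "map_pmf (\<lambda>\<omega>. run_state S c l g \<omega> k) (sample_law S) = draw_state (filter_law S c l g k)"
  shows "map_pmf (\<lambda>\<omega>. decision_state S c l g \<omega> (Suc k)) (sample_law S) =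
         draw_state (observe S (c (Suc k)) (l (Suc k)) (filter_law S c l g k))"
proof -
  let ?A = "draw_state (filter_law S c l g k)"
  have "pair_pmf ?A (law_N S) = pair_pmf ?A (map_pmf snd (pair_pmf (law_W S) (law_N S)))"
    by (simp add: map_snd_pair_pmf)
  also have "\<dots> = map_pmf (\<lambda>(a, w, n). (a, n)) (pair_pmf ?A (pair_pmf (law_W S) (law_N S)))"
    by (simp add: pair_map_pmf2 apsnd_def map_prod_def case_prod_unfold)
  also have "\<dots> = map_pmf (\<lambda>\<omega>. (run_state S c l g \<omega> k, snd (snd \<omega>) (Suc k))) (sample_law S)"
    using arg_cong[OF run_state_independent_of_next[OF assms(1), of c l g],
        of "map_pmf (\<lambda>(a, w, n). (a, n))"]
    by (simp add: pmf.map_comp o_def case_prod_unfold assms(2))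
  finally have *: "pair_pmf ?A (law_N S) =
      map_pmf (\<lambda>\<omega>. (run_state S c l g \<omega> k, snd (snd \<omega>) (Suc k))) (sample_law S)" .
  show ?thesis
    unfolding draw_state_observe * pmf.map_comp o_def decision_state_Suc ..
qed

lemma law_run_state:
  assumes "k \<le> horizon S"
  shows "map_pmf (\<lambda>\<omega>. run_state S c l g \<omega> k) (sample_law S) = draw_state (filter_law S c l g k)"
  using assms
proof (induction k)
  case 0
  have "map_pmf fst (sample_law S) = law_X1 S"
    by (simp add: sample_law_def map_fst_pair_pmf)
  then show ?case
    by (simp add: run_state_def draw_state_def prior_def bind_return_pmf pair_return_pmf2
        pmf.map_comp o_def flip: \<open>map_pmf fst (sample_law S) = law_X1 S\<close>)
next
  case (Suc k)
  then have IH: "map_pmf (\<lambda>\<omega>. decision_state S c l g \<omega> (Suc k)) (sample_law S) =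
         draw_state (observe S (c (Suc k)) (l (Suc k)) (filter_law S c l g k))"
    by (intro law_decision_state_step) auto
  show ?case
    unfolding run_state_Suc filter_law.simps draw_state_act IH[symmetric]
      decision_state_independent_of_next[OF Suc.prems, symmetric] pmf.map_comp o_def ..
qed

lemma law_decision_state:
  assumes "Suc k \<le> horizon S"
  shows "map_pmf (\<lambda>\<omega>. decision_state S c l g \<omega> (Suc k)) (sample_law S) =
         draw_state (observe S (c (Suc k)) (l (Suc k)) (filter_law S c l g k))"
  using law_decision_state_step[OF assms law_run_state] assms by simp

section \<open>Filtered beliefs as conditional laws\<close>

lemma inj_on_snd_iff: "inj_on snd A \<longleftrightarrow> (\<forall>b b' i. (b, i) \<in> A \<longrightarrow> (b', i) \<in> A \<longrightarrow> b = b')"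
  by (fastforce simp: inj_on_def)

lemma inj_on_snd_act:
  assumes "inj_on snd (set_pmf h)"
  shows "inj_on snd (set_pmf (act S g h))"
proof -
  have *: "b = b'" if "(b, i) \<in> set_pmf h" "(b', i) \<in> set_pmf h" for b b' i
    using assms that unfolding inj_on_snd_iff by blast
  show ?thesis
    by (auto simp: act_def inj_on_snd_iff dest: *)
qed

lemma inj_on_snd_observe:
  assumes "inj_on snd (set_pmf h)"
  shows "inj_on snd (set_pmf (observe S c l h))"
proof -
  have *: "b = b'" if "(b, i) \<in> set_pmf h" "(b', i) \<in> set_pmf h" for b b' i
    using assms that unfolding inj_on_snd_iff by blast
  show ?thesis
    by (auto simp: observe_def inj_on_snd_iff dest: *)
qed

text \<open>The filter starts from one belief, and each update uses only data recorded in the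
  history, so the history determines the belief.\<close>

lemma inj_on_snd_filter_law: "inj_on snd (set_pmf (filter_law S c l g k))"
  by (induction k) (simp_all add: inj_on_snd_act inj_on_snd_observe)

text \<open>The snapshot has the law of a hidden state drawn from the filtered belief, and the
  history determines that belief, so \<open>cond_pmf_disintegration\<close> recovers it.\<close>

lemma belief_eq_filter:
  assumes "Suc k \<le> horizon S"
    and "(b, ys, us) \<in> set_pmf (observe S (c (Suc k)) (l (Suc k)) (filter_law S c l g k))"
  shows "belief S c l g (Suc k) ys us = b"
proof -
  let ?h = "observe S (c (Suc k)) (l (Suc k)) (filter_law S c l g k)"
  let ?D = "\<lambda>\<omega>. decision_state S c l g \<omega> (Suc k)"
  \<comment> \<open>Leads to a sample producing this history, so the conditioning event has positive
    probability and \<open>cond_pmf\<close> is specified.\<close>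
  obtain xm where "xm \<in> set_pmf b" using set_pmf_not_empty by fast
  then have "(xm, ys, us) \<in> set_pmf (draw_state ?h)"
    using assms(2) by (force simp: draw_state_def)
  then have "(xm, ys, us) \<in> ?D ` set_pmf (sample_law S)"
    unfolding law_decision_state[OF assms(1), symmetric] by simp
  then obtain \<omega> where "\<omega> \<in> set_pmf (sample_law S)" "?D \<omega> = (xm, ys, us)"
    by auto
  then have "\<omega> \<in> set_pmf (sample_law S) \<inter> ?D -` (snd -` {(ys, us)})"
    by simp
  then have ne: "set_pmf (sample_law S) \<inter> ?D -` (snd -` {(ys, us)}) \<noteq> {}"
    by blast
  have ev: "{\<omega>. outputs S c l g \<omega> (Suc k) = ys \<and> controls S c l g \<omega> (Suc k - 1) = us} =
      ?D -` (snd -` {(ys, us)})"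
    by (auto simp: decision_state_def)
  have "belief S c l g (Suc k) ys us = map_pmf fst (map_pmf ?D (cond_pmf (sample_law S) (?D -` (snd -` {(ys, us)}))))"
    unfolding belief_def ev pmf.map_comp o_def by (simp add: decision_state_def)
  also have "\<dots> = map_pmf fst (cond_pmf (map_pmf ?D (sample_law S)) (snd -` {(ys, us)}))"
    by (simp add: cond_map_pmf[OF ne])
  also have "\<dots> = b"
    unfolding law_decision_state[OF assms(1)] draw_state_def
    by (rule cond_pmf_disintegration[OF inj_on_snd_observe[OF inj_on_snd_filter_law] assms(2)])
  finally show ?thesis .
qed

text \<open>The law at stage \<open>Suc k\<close>.\<close>

abbreviation decision_law where
  "decision_law S c l g k \<equiv> observe S (c (Suc k)) (l (Suc k)) (filter_law S c l g k)"

section \<open>Expected cost expressed through beliefs\<close>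

definition stage_cost ::
    "('x, 'w, 'm, 'z, 'n, 'y, 'u) feedback_system \<Rightarrow> ('x, 'm) belief \<Rightarrow> 'u \<Rightarrow> real" where
  "stage_cost S b u = measure_pmf.expectation b (\<lambda>(x, m). cost S x u)"

definition decision_cost where
  "decision_cost S c l g k =
     measure_pmf.expectation (decision_law S c l g k)
       (\<lambda>(b, ys, us). stage_cost S b (g (Suc k) ys us))"

lemma finite_set_sample_law:
  fixes S :: "('x::finite, 'w::finite, 'm, 'z, 'n::finite, 'y, 'u) feedback_system"
  shows "finite (set_pmf (sample_law S))"
  by (auto simp: sample_law_def set_Pi_pmf intro!: finite_cartesian_product finite_PiE_dflt)

lemma finite_set_observe:
  fixes S :: "('x::finite, 'w, 'm::finite, 'z, 'n, 'y::finite, 'u) feedback_system"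
  shows "finite (set_pmf h) \<Longrightarrow> finite (set_pmf (observe S c l h))"
  by (auto simp: observe_def)

lemma finite_set_filter_law:
  fixes S :: "('x::finite, 'w, 'm::finite, 'z, 'n, 'y::finite, 'u) feedback_system"
  shows "finite (set_pmf (filter_law S c l g k))"
  by (induction k) (simp_all add: act_def finite_set_observe)

text \<open>Tower property: at each decision the cost is first averaged over the hidden state, which
  is distributed as the belief. Index \<open>k\<close> stands for stage
  \<open>Suc k\<close>.\<close>

lemma perf_eq_sum_decision_cost:
  fixes S :: "('x::finite, 'w::finite, 'm::finite, 'z, 'n::finite, 'y::finite, 'u) feedback_system"
  shows "perf S c l g = (\<Sum>k<horizon S. decision_cost S c l g k)"
proof -
  have "measure_pmf.expectation (sample_law S)
      (\<lambda>\<omega>. cost S (X_at S c l g \<omega> (Suc k)) (U_at S c l g \<omega> (Suc k))) = decision_cost S c l g k"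
    if "k < horizon S" for k
  proof -
    let ?F = "\<lambda>((x, m), ys, us). cost S x (g (Suc k) ys us)"
    have "measure_pmf.expectation (sample_law S)
        (\<lambda>\<omega>. cost S (X_at S c l g \<omega> (Suc k)) (U_at S c l g \<omega> (Suc k))) =
      measure_pmf.expectation (map_pmf (\<lambda>\<omega>. decision_state S c l g \<omega> (Suc k)) (sample_law S)) ?F"
      by (simp add: decision_state_def U_at_def)
    also have "\<dots> = measure_pmf.expectation (draw_state (decision_law S c l g k)) ?F"
      using that by (simp add: law_decision_state)
    also have "\<dots> = decision_cost S c l g k"
      unfolding draw_state_def decision_cost_def
      by (subst expectation_bind_pmf_finite)
         (auto simp: finite_set_observe finite_set_filter_law case_prod_unfold stage_cost_def)
    finally show ?thesis .
  qed
  then show ?thesis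
    unfolding perf_def
    by (subst Bochner_Integration.integral_sum)
       (auto intro: integrable_measure_pmf_finite[OF finite_set_sample_law]
             simp: sum.atLeast1_atMost_eq)
qed

section \<open>Calibrated information states\<close>

text \<open>These are the information states whose belief component is correct: given that it equals
  \<open>b\<close>, state and memory content have joint law \<open>b\<close>.\<close>

definition calibrated :: "('x, 'm) belief pmf \<Rightarrow> ('x, 'm) info" where
  "calibrated \<mu> = bind_pmf \<mu> (\<lambda>b. map_pmf (\<lambda>(x, m). (x, m, b)) b)"

lemma info_cost_calibrated:
  fixes S :: "('x::finite, 'w, 'm::finite, 'z, 'n, 'y, 'u) feedback_system"
  assumes "finite (set_pmf \<mu>)"
  shows "info_cost S (calibrated \<mu>) \<gamma> = measure_pmf.expectation \<mu> (\<lambda>b. stage_cost S b (\<gamma> b))"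
  unfolding info_cost_def calibrated_def
  by (subst expectation_bind_pmf_finite) (auto simp: assms stage_cost_def case_prod_unfold)

text \<open>Calibration survives the channel because, by \<open>bayes_disintegration\<close>, the
  output follows \<open>output_law\<close> and the posterior is \<open>bayes\<close>. Only the law
  of the belief needs tracking.\<close>

lemma Qc_calibrated:
  "Qc S c (calibrated \<mu>) =
   calibrated (bind_pmf \<mu> (\<lambda>b. map_pmf (bayes S c b) (output_law S c b)))"
proof -
  have *: "bind_pmf b (\<lambda>xm. map_pmf (\<lambda>n. (fst xm, snd xm, bayes S c b (channel S (c xm) n))) (law_N S)) =
      bind_pmf (output_law S c b) (\<lambda>y. map_pmf (\<lambda>xm. (fst xm, snd xm, bayes S c b y)) (bayes S c b y))" for b
    using arg_cong[OF bayes_disintegration[of b S c],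
        of "map_pmf (\<lambda>(xm, y). (fst xm, snd xm, bayes S c b y))"]
    by (simp add: map_bind_pmf pmf.map_comp o_def)
  show ?thesis
    by (simp add: Qc_def calibrated_def bind_assoc_pmf bind_map_pmf case_prod_unfold *)
qed

lemma Ql_calibrated: "Ql l (calibrated \<mu>) = calibrated (map_pmf (memory_update l) \<mu>)"
  by (simp add: Ql_def calibrated_def map_bind_pmf bind_map_pmf pmf.map_comp o_def
      memory_update_def case_prod_unfold)

lemma Qg_calibrated:
  "Qg S \<gamma> (calibrated \<mu>) = calibrated (map_pmf (\<lambda>b. state_update S (\<gamma> b) b) \<mu>)"
  by (simp add: Qg_def calibrated_def bind_map_pmf map_bind_pmf bind_assoc_pmf pmf.map_comp o_def
      state_update_def case_prod_unfold)

lemma info_init_calibrated: "info_init S = calibrated (return_pmf (prior S))"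
  by (simp add: info_init_def calibrated_def bind_return_pmf prior_def pair_return_pmf2
      pmf.map_comp o_def)

lemma pi_g_calibrated_step:
  assumes "pi_c S c l \<gamma> t = calibrated (map_pmf fst h)"
  shows "pi_g S c l \<gamma> t = calibrated (map_pmf fst (observe S (c t) (l t) h))"
  by (simp add: pi_g.simps pi_l.simps assms Qc_calibrated Ql_calibrated observe_def
      map_bind_pmf bind_map_pmf pmf.map_comp o_def case_prod_unfold)

lemma induced_eq_on_support:
  assumes "k < horizon S"
    and "(b, ys, us) \<in> set_pmf (decision_law S c l (induced S c l \<gamma>) k)"
  shows "induced S c l \<gamma> (Suc k) ys us = \<gamma> (Suc k) b"
  using induced_eq[of "Suc k" S c l \<gamma> ys us] belief_eq_filter[OF _ assms(2)] assms(1) by simp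

text \<open>Each transformation preserves calibration, and on the support the induced controller
  treats a history as \<open>\<gamma>\<close> treats the filtered belief.\<close>

lemma pi_c_calibrated:
  assumes "k \<le> horizon S"
  shows "pi_c S c l \<gamma> (Suc k) = calibrated (map_pmf fst (filter_law S c l (induced S c l \<gamma>) k))"
  using assms
proof (induction k)
  case 0
  show ?case by (simp add: pi_c.simps info_init_calibrated)
next
  case (Suc k)
  let ?g = "induced S c l \<gamma>"
  have "pi_g S c l \<gamma> (Suc k) = calibrated (map_pmf fst (decision_law S c l ?g k))"
    using Suc by (intro pi_g_calibrated_step) simp
  moreover have "map_pmf fst (act S (?g (Suc k)) (decision_law S c l ?g k)) =
      map_pmf (\<lambda>b. state_update S (\<gamma> (Suc k) b) b) (map_pmf fst (decision_law S c l ?g k))"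
    unfolding act_def pmf.map_comp o_def
    by (rule map_pmf_cong) (use Suc.prems in \<open>auto simp: induced_eq_on_support\<close>)
  ultimately show ?case
    by (subst pi_c.simps) (simp add: Qg_calibrated)
qed

lemma pi_g_calibrated:
  assumes "k < horizon S"
  shows "pi_g S c l \<gamma> (Suc k) = calibrated (map_pmf fst (decision_law S c l (induced S c l \<gamma>) k))"
  using assms by (intro pi_g_calibrated_step pi_c_calibrated) simp

lemma perf_S_eq_perf_D:
  fixes S :: "('x::finite, 'w::finite, 'm::finite, 'z, 'n::finite, 'y::finite, 'u) feedback_system"
  shows "perf_S S c l \<gamma> = perf_D S c l \<gamma>"
proof -
  let ?g = "induced S c l \<gamma>"
  have "decision_cost S c l ?g k = info_cost S (pi_g S c l \<gamma> (Suc k)) (\<gamma> (Suc k))"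
    if "k < horizon S" for k
    using that
    by (auto simp: pi_g_calibrated info_cost_calibrated finite_set_observe finite_set_filter_law
        decision_cost_def induced_eq_on_support intro!: expectation_cong_pmf)
  then show ?thesis
    by (simp add: perf_S_def perf_D_def perf_eq_sum_decision_cost sum.atLeast1_atMost_eq)
qed

section \<open>Dynamic programming on beliefs for a fixed encoder and memory\<close>

text \<open>The index counts the stages still to go, so the stage at \<open>Suc j\<close> is \<open>horizon S - j\<close>.\<close>

primrec belief_value ::
    "('x::finite, 'w, 'm::finite, 'z, 'n, 'y, 'u::finite) feedback_system \<Rightarrow> ('x, 'm, 'z) encoders \<Rightarrow>
     ('x, 'm) updates \<Rightarrow> nat \<Rightarrow> ('x, 'm) belief \<Rightarrow> real" where
  "belief_value S c l 0 b = 0"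
| "belief_value S c l (Suc j) b =
     measure_pmf.expectation (output_law S (c (horizon S - j)) b)
       (\<lambda>y. let b' = memory_update (l (horizon S - j)) (bayes S (c (horizon S - j)) b y)
            in MIN u. stage_cost S b' u + belief_value S c l j (state_update S u b'))"

definition action_value where
  "action_value S c l j b u = stage_cost S b u + belief_value S c l j (state_update S u b)"

text \<open>Nondecreasing in \<open>k\<close> for every controller, and constant for the greedy one.\<close>

definition cost_bound where
  "cost_bound S c l g k =
     (\<Sum>i<k. decision_cost S c l g i) +
     measure_pmf.expectation (filter_law S c l g k) (\<lambda>(b, _). belief_value S c l (horizon S - k) b)"

lemma cost_bound_before_decision:
  fixes S :: "('x::finite, 'w, 'm::finite, 'z, 'n, 'y::finite, 'u::finite) feedback_system"
  assumes "k < horizon S"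
  shows "cost_bound S c l g k =
    (\<Sum>i<k. decision_cost S c l g i) +
    measure_pmf.expectation (decision_law S c l g k)
      (\<lambda>(b, _). MIN u. action_value S c l (horizon S - Suc k) b u)"
proof -
  \<comment> \<open>The first identity lets \<open>belief_value\<close> unfold; the second turns the
    stage of its rules into \<open>Suc k\<close>.\<close>
  have "horizon S - k = Suc (horizon S - Suc k)" "horizon S - (horizon S - Suc k) = Suc k"
    using assms by auto
  then show ?thesis
    unfolding cost_bound_def observe_def
    by (subst expectation_bind_pmf_finite)
       (auto simp: finite_set_filter_law case_prod_unfold Let_def action_value_def)
qed

text \<open>The cost of stage \<open>Suc k\<close> is merged with the value after
  \<open>act\<close>. Compared with \<open>cost_bound_before_decision\<close>, the actual control
  replaces the best one.\<close>

lemma cost_bound_after_decision: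
  fixes S :: "('x::finite, 'w, 'm::finite, 'z, 'n, 'y::finite, 'u::finite) feedback_system"
  shows "cost_bound S c l g (Suc k) =
    (\<Sum>i<k. decision_cost S c l g i) +
    measure_pmf.expectation (decision_law S c l g k)
      (\<lambda>(b, ys, us). action_value S c l (horizon S - Suc k) b (g (Suc k) ys us))"
  unfolding cost_bound_def action_value_def case_prod_unfold
  by (subst Bochner_Integration.integral_add)
     (auto intro: integrable_measure_pmf_finite simp: finite_set_observe finite_set_filter_law
       act_def decision_cost_def case_prod_unfold)

lemma cost_bound_0: "cost_bound S c l g 0 = belief_value S c l (horizon S) (prior S)"
  by (simp add: cost_bound_def)

lemma cost_bound_horizon:
  fixes S :: "('x::finite, 'w::finite, 'm::finite, 'z, 'n::finite, 'y::finite, 'u::finite) feedback_system"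
  shows "cost_bound S c l g (horizon S) = perf S c l g"
  by (simp add: cost_bound_def perf_eq_sum_decision_cost case_prod_unfold)

text \<open>No control beats the minimum, so \<open>cost_bound\<close> cannot decrease on its way
  from the belief value at 0 to the cost at the horizon.\<close>

lemma belief_value_le_perf:
  fixes S :: "('x::finite, 'w::finite, 'm::finite, 'z, 'n::finite, 'y::finite, 'u::finite) feedback_system"
  shows "belief_value S c l (horizon S) (prior S) \<le> perf S c l g"
proof -
  have "cost_bound S c l g k \<le> cost_bound S c l g (Suc k)" if "k < horizon S" for k
    unfolding cost_bound_before_decision[OF that] cost_bound_after_decision
    by (intro add_left_mono expectation_mono_pmf)
       (auto simp: finite_set_observe finite_set_filter_law intro!: Min_le)
  then have "k \<le> horizon S \<Longrightarrow> cost_bound S c l g 0 \<le> cost_bound S c l g k" for k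
    by (induction k) (auto intro: order_trans simp: Suc_le_eq)
  then show ?thesis
    using cost_bound_0[of S c l g] cost_bound_horizon[of S c l g] by force
qed

lemma greedy_attains_belief_value:
  fixes S :: "('x::finite, 'w::finite, 'm::finite, 'z, 'n::finite, 'y::finite, 'u::finite) feedback_system"
  assumes "\<And>t b. 1 \<le> t \<Longrightarrow> t \<le> horizon S \<Longrightarrow>
      action_value S c l (horizon S - t) b (\<gamma> t b) = (MIN u. action_value S c l (horizon S - t) b u)"
  shows "perf_S S c l \<gamma> = belief_value S c l (horizon S) (prior S)"
proof -
  let ?g = "induced S c l \<gamma>"
  have "cost_bound S c l ?g k = cost_bound S c l ?g (Suc k)" if "k < horizon S" for k
    unfolding cost_bound_before_decision[OF that] cost_bound_after_decision
    by (intro arg_cong2[where f = "(+)"] refl expectation_cong_pmf)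
       (use that in \<open>auto simp: induced_eq_on_support assms\<close>)
  then have "k \<le> horizon S \<Longrightarrow> cost_bound S c l ?g 0 = cost_bound S c l ?g k" for k
    by (induction k) auto
  then show ?thesis
    using cost_bound_0[of S c l ?g] cost_bound_horizon[of S c l ?g] by (force simp: perf_S_def)
qed

text \<open>With finitely many controls, the minimum is attained at every belief. The lower bound
  does not depend on the controller, so one \<open>\<gamma>\<close> serves all
  \<open>g\<close>.\<close>

lemma belief_controllers_suffice:
  fixes S :: "('x::finite, 'w::finite, 'm::finite, 'z, 'n::finite, 'y::finite, 'u::finite) feedback_system"
  shows "\<exists>\<gamma>. \<forall>g. perf_S S c l \<gamma> \<le> perf S c l g"
proof -
  have "\<exists>u. action_value S c l j b u = (MIN u. action_value S c l j b u)" for j b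
    using Min_in[of "range (action_value S c l j b)"] by (auto simp: image_iff)
  then obtain u where "action_value S c l j b (u j b) = (MIN u. action_value S c l j b u)" for j b
    by metis
  then have "perf_S S c l (\<lambda>t. u (horizon S - t)) = belief_value S c l (horizon S) (prior S)"
    by (intro greedy_attains_belief_value)
  then show ?thesis
    using belief_value_le_perf by metis
qed

section \<open>The nested equations of the deterministic problem\<close>

lemma is_arg_min_UNIV_iff: "is_arg_min f (\<lambda>_. True) x \<longleftrightarrow> (\<forall>y. f x \<le> f y)"
  for f :: "'a \<Rightarrow> real"
  by (auto simp: is_arg_min_linorder)

lemma is_arg_min_eq_Min:
  fixes f :: "'a::finite \<Rightarrow> real"
  assumes "is_arg_min f (\<lambda>_. True) x"
  shows "(MIN y. f y) = f x"
  using assms by (intro Min_eqI) (auto simp: is_arg_min_UNIV_iff)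

lemma is_arg_min_eq_INF:
  fixes f :: "'a \<Rightarrow> real"
  assumes "is_arg_min f (\<lambda>_. True) x"
  shows "(INF y. f y) = f x"
  using assms by (intro cInf_eq_minimum) (auto simp: is_arg_min_UNIV_iff)

lemma ex_is_arg_min_finite_range:
  fixes f :: "'a \<Rightarrow> real"
  assumes "finite (range f)"
  shows "\<exists>x. is_arg_min f (\<lambda>_. True) x"
proof -
  obtain x where "Min (range f) = f x" using Min_in[OF assms] by auto
  then have "f x \<le> f y" for y using Min_le[OF assms, of "f y"] by simp
  then show ?thesis by (auto simp: is_arg_min_UNIV_iff)
qed

text \<open>In the reals \<open>cINF_lower\<close> needs the infimum over controllers to be bounded
  below; nonnegative costs provide the bound 0.\<close>

lemma
  fixes S :: "('x::finite, 'w, 'm::finite, 'z::finite, 'n, 'y, 'u) feedback_system"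
  assumes cost: "\<And>x u. 0 \<le> cost S x u"
  shows Vc_nonneg: "0 \<le> Vc S t \<pi>" and Vg_arg_nonneg: "0 \<le> Vg_arg S t \<pi> \<gamma>"
proof -
  have info: "0 \<le> info_cost S \<pi> \<gamma>" for \<pi> :: "('x, 'm) info" and \<gamma>
    unfolding info_cost_def by (intro Bochner_Integration.integral_nonneg) (auto simp: cost)
  have arg: "0 \<le> Vg_arg S t \<pi> \<gamma>" if "t < horizon S \<Longrightarrow> \<forall>\<pi>. 0 \<le> Vc S (t + 1) \<pi>" for t \<pi> \<gamma>
    using that by (auto simp: Vg_arg_def info)
  have Vc: "0 \<le> Vc S t \<pi>" if "\<And>\<pi> \<gamma>. 0 \<le> Vg_arg S t \<pi> \<gamma>" for t \<pi>
  proof -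
    have "0 \<le> Vg S t \<pi>" for \<pi>
      unfolding Vg_eq_INF by (intro cINF_greatest that) simp
    then have "0 \<le> Vl S t \<pi>" for \<pi>
      by (simp add: Vl.simps)
    then show ?thesis
      by (simp add: Vc.simps)
  qed
  have "\<forall>\<pi> \<gamma>. 0 \<le> Vg_arg S t \<pi> \<gamma>" for t
  \<comment> \<open>\<open>arg\<close> and \<open>Vc\<close> feed each other; the circle is broken
    at the horizon, where \<open>Vg_arg\<close> has no continuation term.\<close>
  proof (induction "horizon S - t" arbitrary: t rule: less_induct)
    case less
    then have "\<forall>\<pi>. 0 \<le> Vc S (t + 1) \<pi>" if "t < horizon S"
      using that by (intro allI Vc) simp
    then show ?case using arg by blast
  qed
  then show "0 \<le> Vc S t \<pi>" "0 \<le> Vg_arg S t \<pi> \<gamma>" by (auto intro: Vc)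
qed

lemma Vc_le_Vg_arg:
  fixes S :: "('x::finite, 'w, 'm::finite, 'z::finite, 'n, 'y, 'u) feedback_system"
  assumes cost: "\<And>x u. 0 \<le> cost S x u"
  shows "Vc S t (pi_c S c l \<gamma> t) \<le> Vg_arg S t (pi_g S c l \<gamma> t) (\<gamma> t)"
proof -
  have "Vc S t (pi_c S c l \<gamma> t) \<le> Vl S t (pi_l S c l \<gamma> t)"
    by (auto simp: Vc.simps pi_l.simps intro!: Min_le)
  also have "\<dots> \<le> Vg S t (pi_g S c l \<gamma> t)"
    by (auto simp: Vl.simps pi_g.simps intro!: Min_le)
  also have "\<dots> \<le> Vg_arg S t (pi_g S c l \<gamma> t) (\<gamma> t)"
    unfolding Vg_eq_INF
    by (intro cINF_lower bdd_belowI2[where m = 0] Vg_arg_nonneg cost) simp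
  finally show ?thesis .
qed

lemma Vc_eq_Vg_arg:
  assumes "nested_optimal S c l \<gamma>" "t \<in> {1..horizon S}"
  shows "Vc S t (pi_c S c l \<gamma> t) = Vg_arg S t (pi_g S c l \<gamma> t) (\<gamma> t)"
proof -
  have c: "is_arg_min (\<lambda>c'. Vl S t (Qc S c' (pi_c S c l \<gamma> t))) (\<lambda>_. True) (c t)"
    and l: "is_arg_min (\<lambda>l'. Vg S t (Ql l' (pi_l S c l \<gamma> t))) (\<lambda>_. True) (l t)"
    and \<gamma>: "is_arg_min (Vg_arg S t (pi_g S c l \<gamma> t)) (\<lambda>_. True) (\<gamma> t)"
    using assms by (auto simp: nested_optimal_def)
  have "Vc S t (pi_c S c l \<gamma> t) = Vl S t (pi_l S c l \<gamma> t)"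
    by (simp only: Vc.simps pi_l.simps is_arg_min_eq_Min[OF c])
  also have "\<dots> = Vg S t (pi_g S c l \<gamma> t)"
    by (simp only: Vl.simps pi_g.simps is_arg_min_eq_Min[OF l])
  also have "\<dots> = Vg_arg S t (pi_g S c l \<gamma> t) (\<gamma> t)"
    by (simp only: Vg_eq_INF is_arg_min_eq_INF[OF \<gamma>])
  finally show ?thesis .
qed

text \<open>The continuation in \<open>Vg_arg\<close> is the value at the next \<open>pi_c\<close>,
  so all values but the first cancel. Nonnegative gaps then give the lower bound, zero gaps
  attainment.\<close>

lemma perf_D_telescope:
  assumes "horizon S \<ge> 1"
  shows "perf_D S c l \<gamma> - Vc S 1 (info_init S) =
    (\<Sum>t = 1..horizon S. Vg_arg S t (pi_g S c l \<gamma> t) (\<gamma> t) - Vc S t (pi_c S c l \<gamma> t))"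
proof -
  \<comment> \<open>Setting \<open>v\<close> to 0 past the last stage matches the missing
    continuation in \<open>Vg_arg\<close>. Since the horizon is at least 1, \<open>v 0\<close> is
    the initial value.\<close>
  define v where "v k = (if k < horizon S then Vc S (Suc k) (pi_c S c l \<gamma> (Suc k)) else 0)" for k
  have "Vg_arg S (Suc k) (pi_g S c l \<gamma> (Suc k)) (\<gamma> (Suc k)) - Vc S (Suc k) (pi_c S c l \<gamma> (Suc k)) =
      info_cost S (pi_g S c l \<gamma> (Suc k)) (\<gamma> (Suc k)) + (v (Suc k) - v k)" if "k < horizon S" for k
    using that by (simp add: Vg_arg_def v_def pi_c.simps[of S c l \<gamma> "Suc (Suc k)"])
  then have "(\<Sum>t = 1..horizon S. Vg_arg S t (pi_g S c l \<gamma> t) (\<gamma> t) - Vc S t (pi_c S c l \<gamma> t)) =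
      perf_D S c l \<gamma> + (\<Sum>k<horizon S. v (Suc k) - v k)"
    by (simp add: perf_D_def sum.atLeast1_atMost_eq sum.distrib)
  also have "\<dots> = perf_D S c l \<gamma> - Vc S 1 (info_init S)"
    unfolding sum_lessThan_telescope using assms by (simp add: v_def pi_c.simps)
  finally show ?thesis by simp
qed

lemma Vc_le_perf_D:
  fixes S :: "('x::finite, 'w, 'm::finite, 'z::finite, 'n, 'y, 'u) feedback_system"
  assumes "horizon S \<ge> 1" "\<And>x u. 0 \<le> cost S x u"
  shows "Vc S 1 (info_init S) \<le> perf_D S c l \<gamma>"
proof -
  have "0 \<le> perf_D S c l \<gamma> - Vc S 1 (info_init S)"
    unfolding perf_D_telescope[OF assms(1)]
    by (intro sum_nonneg) (simp add: Vc_le_Vg_arg[OF assms(2)])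
  then show ?thesis by simp
qed

lemma nested_optimal_perf_D:
  assumes "horizon S \<ge> 1" "nested_optimal S c l \<gamma>"
  shows "perf_D S c l \<gamma> = Vc S 1 (info_init S)"
  using perf_D_telescope[OF assms(1), of c l \<gamma>] Vc_eq_Vg_arg[OF assms(2)] by simp

section \<open>Existence of a nested design\<close>

text \<open>On a finitely supported information state a controller acts through finitely many values.\<close>

lemma finite_range_Vg_arg:
  fixes S :: "('x::finite, 'w, 'm::finite, 'z::finite, 'n, 'y, 'u::finite) feedback_system"
  assumes "finite (set_pmf \<pi>)"
  shows "finite (range (Vg_arg S t \<pi>))"
proof -
  define B where "B = (\<lambda>(x, m, p). p) ` set_pmf \<pi>"
  have "Vg_arg S t \<pi> \<gamma> = Vg_arg S t \<pi> (restrict \<gamma> B)" for \<gamma>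
  proof -
    have "restrict \<gamma> B p = \<gamma> p" if "(x, m, p) \<in> set_pmf \<pi>" for x m p
      using that by (force simp: B_def)
    then have "info_cost S \<pi> \<gamma> = info_cost S \<pi> (restrict \<gamma> B)" "Qg S \<gamma> \<pi> = Qg S (restrict \<gamma> B) \<pi>"
      unfolding info_cost_def Qg_def
      by (auto intro!: expectation_cong_pmf bind_pmf_cong)
    then show ?thesis by (simp add: Vg_arg_def)
  qed
  then have "range (Vg_arg S t \<pi>) \<subseteq> Vg_arg S t \<pi> ` (PiE B (\<lambda>_. UNIV))"
    by (intro image_subsetI) (rule image_eqI[of _ _ "restrict _ B"], assumption, simp)
  moreover have "finite (PiE B (\<lambda>_. UNIV :: 'u set))"
    using assms by (intro finite_PiE) (auto simp: B_def)
  ultimately show ?thesis by (meson finite_imageI finite_subset)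
qed

text \<open>The conditions refer to states generated by the design itself. Minimisers are therefore
  selected at all relevant information states, the system is run forward under these selectors, and
  the rules are read off along the path.\<close>

lemma ex_nested_optimal:
  fixes S :: "('x::finite, 'w::finite, 'm::finite, 'z::finite, 'n::finite, 'y, 'u::finite) feedback_system"
  shows "\<exists>c l \<gamma>. nested_optimal S c l \<gamma>"
proof -
  have "\<forall>t \<pi>. \<exists>c'. is_arg_min (\<lambda>c'. Vl S t (Qc S c' \<pi>)) (\<lambda>_. True) c'"
    by (intro allI ex_is_arg_min_finite_range) simp
  then obtain C where C: "\<And>t \<pi>. is_arg_min (\<lambda>c. Vl S t (Qc S c \<pi>)) (\<lambda>_. True) (C t \<pi>)"
    by metis
  have "\<forall>t \<pi>. \<exists>l'. is_arg_min (\<lambda>l'. Vg S t (Ql l' \<pi>)) (\<lambda>_. True) l'"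
    by (intro allI ex_is_arg_min_finite_range) simp
  then obtain L where L: "\<And>t \<pi>. is_arg_min (\<lambda>l. Vg S t (Ql l \<pi>)) (\<lambda>_. True) (L t \<pi>)"
    by metis
  \<comment> \<open>A minimising controller is claimed only for finite support, where
    \<open>finite_range_Vg_arg\<close> applies; \<open>fin\<close> below covers the path.\<close>
  have "\<forall>t \<pi>. \<exists>\<gamma>. finite (set_pmf \<pi>) \<longrightarrow> is_arg_min (Vg_arg S t \<pi>) (\<lambda>_. True) \<gamma>"
    using ex_is_arg_min_finite_range[OF finite_range_Vg_arg] by blast
  then obtain G where
    G: "\<And>t \<pi>. finite (set_pmf \<pi>) \<Longrightarrow> is_arg_min (Vg_arg S t \<pi>) (\<lambda>_. True) (G t \<pi>)"
    by metis
  define after_c where "after_c t \<pi> = Qc S (C t \<pi>) \<pi>" for t \<pi>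
  define after_l where "after_l t \<pi> = Ql (L t (after_c t \<pi>)) (after_c t \<pi>)" for t \<pi>
  \<comment> \<open>\<open>st k\<close> is the intended \<open>pi_c\<close> at stage
    \<open>Suc k\<close>, hence the argument \<open>t - 1\<close> in the rules below.\<close>
  define st where "st = rec_nat (info_init S)
    (\<lambda>k \<pi>. Qg S (G (Suc k) (after_l (Suc k) \<pi>)) (after_l (Suc k) \<pi>))"
  define c where "c t = C t (st (t - 1))" for t
  define l where "l t = L t (after_c t (st (t - 1)))" for t
  define \<gamma> where "\<gamma> t = G t (after_l t (st (t - 1)))" for t
  have fin: "finite (set_pmf (st k))" "finite (set_pmf (after_l t (st k)))" for k t
  proof -
    have step: "finite (set_pmf (after_l t \<pi>))" if "finite (set_pmf \<pi>)" for t \<pi>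
      using that by (auto simp: after_l_def after_c_def Ql_def Qc_def case_prod_unfold)
    show "finite (set_pmf (st k))"
      by (induction k) (auto simp: st_def info_init_def Qg_def case_prod_unfold step)
    then show "finite (set_pmf (after_l t (st k)))" by (rule step)
  qed
  \<comment> \<open>The rules do generate the path along which they were chosen.\<close>
  have pi: "pi_c S c l \<gamma> (Suc k) = st k \<and> pi_l S c l \<gamma> (Suc k) = after_c (Suc k) (st k) \<and>
      pi_g S c l \<gamma> (Suc k) = after_l (Suc k) (st k)" for k
  proof -
    have *: "pi_l S c l \<gamma> (Suc k) = after_c (Suc k) (st k) \<and>
        pi_g S c l \<gamma> (Suc k) = after_l (Suc k) (st k)" if "pi_c S c l \<gamma> (Suc k) = st k" for k
      using that by (simp add: pi_l.simps pi_g.simps after_c_def after_l_def c_def l_def)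
    have "pi_c S c l \<gamma> (Suc k) = st k"
    proof (induction k)
      case 0
      show ?case by (simp add: pi_c.simps st_def)
    next
      case (Suc k)
      have "st (Suc k) = Qg S (\<gamma> (Suc k)) (after_l (Suc k) (st k))"
        by (simp add: st_def \<gamma>_def)
      then show ?case
        using *[OF Suc] by (subst pi_c.simps) simp
    qed
    with * show ?thesis by simp
  qed
  have "nested_optimal S c l \<gamma>"
    unfolding nested_optimal_def
  proof
    fix t assume "t \<in> {1..horizon S}"
    then obtain k where t: "t = Suc k" by (cases t) auto
    show "is_arg_min (\<lambda>c'. Vl S t (Qc S c' (pi_c S c l \<gamma> t))) (\<lambda>_. True) (c t) \<and>
        is_arg_min (\<lambda>l'. Vg S t (Ql l' (pi_l S c l \<gamma> t))) (\<lambda>_. True) (l t) \<and>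
        is_arg_min (\<lambda>\<gamma>'. Vg_arg S t (pi_g S c l \<gamma> t) \<gamma>') (\<lambda>_. True) (\<gamma> t)"
      using C L G[OF fin(2)] pi[of k] by (simp add: t c_def l_def \<gamma>_def)
  qed
  then show ?thesis by blast
qed

theorem theorem2:
  fixes S :: "('x::finite, 'w::finite, 'm::finite, 'z::finite, 'n::finite, 'y::finite, 'u::finite)
                feedback_system"
    and K :: real
  assumes "horizon S \<ge> 1"
    and "\<And>x u. 0 \<le> cost S x u \<and> cost S x u \<le> K"
  shows "(\<exists>c l \<gamma>. nested_optimal S c l \<gamma>) \<and>
         (\<forall>c l \<gamma>. nested_optimal S c l \<gamma> \<longrightarrow>
            optimal_D S c l \<gamma> \<and> optimal_S S c l \<gamma> \<and> optimal_B S c l (induced S c l \<gamma>)) \<and>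
         optimal_perf S = Vc S 1 (info_init S)"
proof -
  let ?V = "Vc S 1 (info_init S)"
  have D: "?V \<le> perf_D S c l \<gamma>" for c l \<gamma>
    using Vc_le_perf_D[of S] assms by blast
  \<comment> \<open>A history-dependent controller is replaced by a belief controller with the same
    encoder and memory, to which the bound for (D) applies.\<close>
  have B: "?V \<le> perf S c l g" for c l g
  proof -
    obtain \<gamma> where "perf_S S c l \<gamma> \<le> perf S c l g"
      using belief_controllers_suffice[of S c l] by blast
    with D[of c l \<gamma>] show ?thesis by (simp add: perf_S_eq_perf_D)
  qed
  have attained: "perf_D S c l \<gamma> = ?V" "perf_S S c l \<gamma> = ?V" "perf S c l (induced S c l \<gamma>) = ?V"
    if "nested_optimal S c l \<gamma>" for c l \<gamma>
    using nested_optimal_perf_D[OF assms(1) that] perf_S_eq_perf_D[of S c l \<gamma>]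
    by (simp_all add: perf_S_def)
  \<comment> \<open>Through \<open>induced\<close>, a design for (S) is a particular design for
    (B).\<close>
  have S: "?V \<le> perf_S S c l \<gamma>" for c l \<gamma>
    unfolding perf_S_def by (rule B)
  obtain c l \<gamma> where opt: "nested_optimal S c l \<gamma>" using ex_nested_optimal[of S] by blast
  have "optimal_perf S = ?V"
    unfolding optimal_perf_def
  proof (rule cInf_eq_minimum)
    show "?V \<in> range (\<lambda>(c, l, g). perf S c l g)"
      using attained(3)[OF opt] by (intro image_eqI[of _ _ "(c, l, induced S c l \<gamma>)"]) auto
  qed (auto intro: B simp del: One_nat_def)
  then show ?thesis
    using opt by (auto simp: optimal_D_def optimal_S_def optimal_B_def attained intro: D S B
        simp del: One_nat_def)
qed

end
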